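(* Let $\mathcal{B}$ be an unconditional basis in a quasi-Banach space $\mathbb{B}$ and $\alpha>0$. Suppose that there exist integers $p_N\ge q_N\ge1$, $N=1,2,\dots$, such that $$\lim_{N\to\infty}\frac{p_N}{q_N}=\infty\quad\text{and}\quad \frac{h_r(q_N)}{h_\ell(p_N)}\gtrsim\Big(\frac{p_N}{q_N}\Big)^\alpha .$$ Then the inclusion $\mathcal{A}^\alpha_\tau(\mathcal{B},\mathbb{B})\hookrightarrow\mathscr{G}^\alpha_\tau(\mathcal{B},\mathbb{B})$ does not hold for any $\tau\in(0,\infty]$.
   Context: Basis. $(\mathbb{B},\|\cdot\|_{\mathbb{B}})$ is a quasi-Banach space whose quasi-norm satisfies $\|x+y\|_{\mathbb{B}}^{\rho}\le\|x\|_{\mathbb{B}}^{\rho}+\|y\|_{\mathbb{B}}^{\rho}$ for some fixed $\rho\in(0,1]$. A sequence $\mathcal{B}=\{e_j\}_{j=1}^\infty$ is a basis if each $x\in\mathbb{B}$ is uniquely $x=\sum_j c_je_j$ with convergence in $\|\cdot\|_{\mathbb{B}}$; it is unconditional (with constant $K$) if $\|\sum_j\lambda_jc_je_j\|_{\mathbb{B}}\le K\|\sum_jc_je_j\|_{\mathbb{B}}$ whenever $|\lambda_j|\le1$. Standing assumptions: $\|e_j\|_{\mathbb{B}}=1$ for all $j$ and $K=1$. Democracy functions. $h_r(N)=\sup_{|\Gamma|=N}\|\sum_{k\in\Gamma}e_k\|_{\mathbb{B}}$ and $h_\ell(N)=\inf_{|\Gamma|=N}\|\sum_{k\in\Gamma}e_k\|_{\mathbb{B}}$,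 over $\Gamma\subset\mathbb{N}$, $N=1,2,\dots$. Approximation spaces and greedy classes. $\Sigma_N$ is the set of $y\in\mathbb{B}$ with at most $N$ nonzero coefficients; $\sigma_N(x)=\inf_{y\in\Sigma_N}\|x-y\|_{\mathbb{B}}$. For $x=\sum_jc_je_j$, and any bijection $\pi$ of $\mathbb{N}$ with $|c_{\pi(j)}|\ge|c_{\pi(j+1)}|$ for all $j$, let $G_N^\pi(x)=\sum_{j=1}^Nc_{\pi(j)}e_{\pi(j)}$, and $\gamma_N(x)=\sup_\pi\|x-G_N^\pi(x)\|_{\mathbb{B}}$ over all such $\pi$. For $\alpha>0$, $0<\tau\le\infty$, $\mathcal{A}^\alpha_\tau(\mathcal{B},\mathbb{B})$ is the set of $x\in\mathbb{B}$ with $\|x\|_{\mathcal{A}^\alpha_\tau}=\|x\|_{\mathbb{B}}+\big[\sum_{N\ge1}(N^\alpha\sigma_N(x))^\tau\frac1N\big]^{1/\tau}<\infty$ (with $\sup_{N\ge1}N^\alpha\sigma_N(x)$ instead of the bracket if $\tau=\infty$); $\mathscr{G}^\alpha_\tau(\mathcal{B},\mathbb{B})$ and $\|\cdot\|_{\mathscr{G}^\alpha_\tau}$ are defined in the same way with $\gamma_N$ in place of $\sigma_N$. $X\hookrightarrow Y$ means $X\subset Y$ and there is $C>0$ with $\|x\|_Y\le C\|x\|_X$ for all $x\in X$. $a_N\gtrsim b_N$ means $a_N\ge c\,b_N$ for all $N$ with $c>0$ independent of $N$. *)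

theory Defs
  imports "HOL-Analysis.Analysis"
begin

(* The scalar field is an arbitrary real_normed_field, i.e. up to isometric isomorphism the
   real or the complex numbers.  The space is the whole type 'b; its topology is given by nrm. *)

locale quasi_banach = vector_space smul
  for smul :: "'k::real_normed_field \<Rightarrow> 'b::ab_group_add \<Rightarrow> 'b" +
  fixes nrm :: "'b \<Rightarrow> real" and \<rho> :: real
  assumes rho_pos: "0 < \<rho>" and rho_le_1: "\<rho> \<le> 1"
    and nrm_nonneg: "0 \<le> nrm x"
    and nrm_eq_0_iff: "nrm x = 0 \<longleftrightarrow> x = 0"
    and nrm_scale: "nrm (smul a x) = norm a * nrm x"
    and nrm_triangle: "nrm (x + y) powr \<rho> \<le> nrm x powr \<rho> + nrm y powr \<rho>"
    and complete: "\<forall>\<epsilon>>0. \<exists>M. \<forall>m\<ge>M. \<forall>n\<ge>M. nrm (X m - X n) < \<epsilon> \<Longrightarrow>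
                   \<exists>x. (\<lambda>n. nrm (X n - x)) \<longlonglongrightarrow> 0"

(* Sequences (e_j), (c_j) and the orderings below are indexed from 0 instead of 1. *)

definition has_expansion ::
    "('k::real_normed_field \<Rightarrow> 'b::ab_group_add \<Rightarrow> 'b) \<Rightarrow> ('b \<Rightarrow> real) \<Rightarrow> (nat \<Rightarrow> 'b)
      \<Rightarrow> 'b \<Rightarrow> (nat \<Rightarrow> 'k) \<Rightarrow> bool" where
  "has_expansion smul nrm e x c \<longleftrightarrow>
     (\<lambda>n. nrm (x - (\<Sum>j<n. smul (c j) (e j)))) \<longlonglongrightarrow> 0"

definition is_basis ::
    "('k::real_normed_field \<Rightarrow> 'b::ab_group_add \<Rightarrow> 'b) \<Rightarrow> ('b \<Rightarrow> real) \<Rightarrow> (nat \<Rightarrow> 'b) \<Rightarrow> bool" where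
  "is_basis smul nrm e \<longleftrightarrow> (\<forall>x. \<exists>!c. has_expansion smul nrm e x c)"

definition unconditional_basis ::
    "('k::real_normed_field \<Rightarrow> 'b::ab_group_add \<Rightarrow> 'b) \<Rightarrow> ('b \<Rightarrow> real) \<Rightarrow> (nat \<Rightarrow> 'b)
      \<Rightarrow> real \<Rightarrow> bool" where
  "unconditional_basis smul nrm e K \<longleftrightarrow> is_basis smul nrm e \<and>
     (\<forall>x c l. has_expansion smul nrm e x c \<and> (\<forall>j. norm (l j) \<le> 1) \<longrightarrow>
        (\<exists>y. has_expansion smul nrm e y (\<lambda>j. l j * c j) \<and> nrm y \<le> K * nrm x))"

definition basis_coeff ::
    "('k::real_normed_field \<Rightarrow> 'b::ab_group_add \<Rightarrow> 'b) \<Rightarrow> ('b \<Rightarrow> real) \<Rightarrow> (nat \<Rightarrow> 'b)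
      \<Rightarrow> 'b \<Rightarrow> nat \<Rightarrow> 'k" where
  "basis_coeff smul nrm e x = (THE c. has_expansion smul nrm e x c)"

(* The real suprema are over bounded sets: if nrm (e j) = 1 for all j, the rho-triangle
   inequality bounds the values by N powr (1/rho). *)

definition democracy_upper :: "('b::ab_group_add \<Rightarrow> real) \<Rightarrow> (nat \<Rightarrow> 'b) \<Rightarrow> nat \<Rightarrow> real" where
  "democracy_upper nrm e N = (SUP \<Gamma>\<in>{\<Gamma>. finite \<Gamma> \<and> card \<Gamma> = N}. nrm (\<Sum>k\<in>\<Gamma>. e k))"

definition democracy_lower :: "('b::ab_group_add \<Rightarrow> real) \<Rightarrow> (nat \<Rightarrow> 'b) \<Rightarrow> nat \<Rightarrow> real" where
  "democracy_lower nrm e N = (INF \<Gamma>\<in>{\<Gamma>. finite \<Gamma> \<and> card \<Gamma> = N}. nrm (\<Sum>k\<in>\<Gamma>. e k))"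

definition sparse_set ::
    "('k::real_normed_field \<Rightarrow> 'b::ab_group_add \<Rightarrow> 'b) \<Rightarrow> ('b \<Rightarrow> real) \<Rightarrow> (nat \<Rightarrow> 'b)
      \<Rightarrow> nat \<Rightarrow> 'b set" where
  "sparse_set smul nrm e N =
     {y. finite {j. basis_coeff smul nrm e y j \<noteq> 0} \<and>
         card {j. basis_coeff smul nrm e y j \<noteq> 0} \<le> N}"

definition sigma_err ::
    "('k::real_normed_field \<Rightarrow> 'b::ab_group_add \<Rightarrow> 'b) \<Rightarrow> ('b \<Rightarrow> real) \<Rightarrow> (nat \<Rightarrow> 'b)
      \<Rightarrow> 'b \<Rightarrow> nat \<Rightarrow> ennreal" where
  "sigma_err smul nrm e x N = (INF y\<in>sparse_set smul nrm e N. ennreal (nrm (x - y)))"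

definition greedy_orderings ::
    "('k::real_normed_field \<Rightarrow> 'b::ab_group_add \<Rightarrow> 'b) \<Rightarrow> ('b \<Rightarrow> real) \<Rightarrow> (nat \<Rightarrow> 'b)
      \<Rightarrow> 'b \<Rightarrow> (nat \<Rightarrow> nat) set" where
  "greedy_orderings smul nrm e x =
     {\<pi>. bij \<pi> \<and> (\<forall>j. norm (basis_coeff smul nrm e x (\<pi> j)) \<ge>
                     norm (basis_coeff smul nrm e x (\<pi> (Suc j))))}"

definition greedy_sum ::
    "('k::real_normed_field \<Rightarrow> 'b::ab_group_add \<Rightarrow> 'b) \<Rightarrow> ('b \<Rightarrow> real) \<Rightarrow> (nat \<Rightarrow> 'b)
      \<Rightarrow> (nat \<Rightarrow> nat) \<Rightarrow> nat \<Rightarrow> 'b \<Rightarrow> 'b" where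
  "greedy_sum smul nrm e \<pi> N x =
     (\<Sum>j<N. smul (basis_coeff smul nrm e x (\<pi> j)) (e (\<pi> j)))"

(* If x has infinitely many nonzero coefficients and also some zero ones, then no bijection
   of nat is a greedy ordering and gamma_err x N = 0, the empty supremum.  For such x this is
   the least possible value, so it only enlarges the greedy class and shrinks its quasi-norm;
   the failure of an embedding into the greedy class then follows for any larger choice of
   gamma_err at such x, e.g. with injections whose range contains the support of x. *)

definition gamma_err ::
    "('k::real_normed_field \<Rightarrow> 'b::ab_group_add \<Rightarrow> 'b) \<Rightarrow> ('b \<Rightarrow> real) \<Rightarrow> (nat \<Rightarrow> 'b)
      \<Rightarrow> 'b \<Rightarrow> nat \<Rightarrow> ennreal" where
  "gamma_err smul nrm e x N =
     (SUP \<pi>\<in>greedy_orderings smul nrm e x. ennreal (nrm (x - greedy_sum smul nrm e \<pi> N x)))"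

(* u to the power p, for p > 0 *)

definition ennpowr :: "ennreal \<Rightarrow> real \<Rightarrow> ennreal" where
  "ennpowr u p = (if u = \<infinity> then \<infinity> else ennreal (enn2real u powr p))"

(* Both versions only involve the values a N with N \<ge> 1; 0 < \<tau> \<le> \<infinity>. *)

definition weighted_lseq :: "real \<Rightarrow> ennreal \<Rightarrow> (nat \<Rightarrow> ennreal) \<Rightarrow> ennreal" where
  "weighted_lseq \<alpha> \<tau> a =
     (if \<tau> = \<infinity> then (SUP N\<in>{1..}. ennreal (real N powr \<alpha>) * a N)
      else ennpowr
        (\<Sum>n. ennpowr (ennreal (real (Suc n) powr \<alpha>) * a (Suc n)) (enn2real \<tau>)
              * ennreal (1 / real (Suc n)))
        (1 / enn2real \<tau>))"

definition approx_norm ::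
    "('k::real_normed_field \<Rightarrow> 'b::ab_group_add \<Rightarrow> 'b) \<Rightarrow> ('b \<Rightarrow> real) \<Rightarrow> (nat \<Rightarrow> 'b)
      \<Rightarrow> real \<Rightarrow> ennreal \<Rightarrow> 'b \<Rightarrow> ennreal" where
  "approx_norm smul nrm e \<alpha> \<tau> x =
     ennreal (nrm x) + weighted_lseq \<alpha> \<tau> (sigma_err smul nrm e x)"

definition approx_space ::
    "('k::real_normed_field \<Rightarrow> 'b::ab_group_add \<Rightarrow> 'b) \<Rightarrow> ('b \<Rightarrow> real) \<Rightarrow> (nat \<Rightarrow> 'b)
      \<Rightarrow> real \<Rightarrow> ennreal \<Rightarrow> 'b set" where
  "approx_space smul nrm e \<alpha> \<tau> = {x. approx_norm smul nrm e \<alpha> \<tau> x < \<infinity>}"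

definition greedy_norm ::
    "('k::real_normed_field \<Rightarrow> 'b::ab_group_add \<Rightarrow> 'b) \<Rightarrow> ('b \<Rightarrow> real) \<Rightarrow> (nat \<Rightarrow> 'b)
      \<Rightarrow> real \<Rightarrow> ennreal \<Rightarrow> 'b \<Rightarrow> ennreal" where
  "greedy_norm smul nrm e \<alpha> \<tau> x =
     ennreal (nrm x) + weighted_lseq \<alpha> \<tau> (gamma_err smul nrm e x)"

definition greedy_class ::
    "('k::real_normed_field \<Rightarrow> 'b::ab_group_add \<Rightarrow> 'b) \<Rightarrow> ('b \<Rightarrow> real) \<Rightarrow> (nat \<Rightarrow> 'b)
      \<Rightarrow> real \<Rightarrow> ennreal \<Rightarrow> 'b set" where
  "greedy_class smul nrm e \<alpha> \<tau> = {x. greedy_norm smul nrm e \<alpha> \<tau> x < \<infinity>}"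

definition continuously_included ::
    "'b set \<Rightarrow> ('b \<Rightarrow> ennreal) \<Rightarrow> 'b set \<Rightarrow> ('b \<Rightarrow> ennreal) \<Rightarrow> bool" where
  "continuously_included X normX Y normY \<longleftrightarrow>
     X \<subseteq> Y \<and> (\<exists>C::real. C > 0 \<and> (\<forall>x\<in>X. normY x \<le> ennreal C * normX x))"

end

theory Submission
  imports Defs
begin

text \<open>
  The inclusion fails because it fails quantitatively on indicator vectors of finite sets.
  Write \<open>1\<^sub>\<Gamma> = sum e \<Gamma>\<close>.  For \<open>p \<ge> 2 q\<close> choose \<open>Gr\<close> with \<open>q\<close> elements and \<open>Gl\<close> with
  \<open>p\<close> elements, nearly extremal for \<open>h\<^sub>r(q)\<close> and \<open>h\<^sub>\<ell>(p)\<close>, and put \<open>x = sum e (Gl \<union> Gr)\<close>.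
  All nonzero coefficients of \<open>x\<close> are equal, so a greedy ordering may exhaust \<open>Gl - Gr\<close>
  before it touches \<open>Gr\<close>, whereas a good approximation removes the expensive set \<open>Gr\<close> first.  With
  \<open>R = \<parallel>1\<^bsub>Gr\<^esub>\<parallel>\<close> and \<open>l = \<parallel>1\<^bsub>Gl - Gr\<^esub>\<parallel>\<close> this has two consequences.

  \<^item> The greedy error is at least \<open>R\<close> for every \<open>N \<le> card (Gl - Gr)\<close>, a number which is at
    least \<open>p / 2\<close> (lemma \<open>gamma_err_sum_ge\<close>).  Hence the greedy quasi-norm of \<open>x\<close> is bounded
    below by a multiple of \<open>p\<^sup>\<alpha> R\<close> (lemma \<open>weighted_lseq_step_lower\<close>).

  \<^item> The best approximation error is at most \<open>\<parallel>x\<parallel>\<close> always, at most \<open>l\<close> for \<open>N \<ge> q\<close>, and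
    zero for \<open>N > 2 p\<close> (lemma \<open>sigma_err_sum_le\<close>).  Hence the approximation quasi-norm is at
    most a multiple of \<open>q\<^sup>\<alpha> \<parallel>x\<parallel> + p\<^sup>\<alpha> l\<close> (lemma \<open>weighted_lseq_two_step_upper\<close>).  The
    assumption on the democracy functions gives that \<open>p\<^sup>\<alpha> l\<close> is dominated by
    \<open>q\<^sup>\<alpha> R\<close>; in particular \<open>l\<close> and \<open>\<parallel>x\<parallel>\<close> are dominated by \<open>R\<close>, so the whole bound is a
    multiple of \<open>q\<^sup>\<alpha> R\<close>.

  A continuous inclusion would therefore bound \<open>(p / q)\<^sup>\<alpha>\<close> by a constant, while \<open>p / q\<close> tends
  to infinity.
\<close>

section \<open>Weighted sequence norms of step functions\<close>

lemma ennpowr_ennreal: "0 \<le> x \<Longrightarrow> ennpowr (ennreal x) t = ennreal (x powr t)"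
  by (simp add: ennpowr_def)

lemma ennpowr_mono: "u \<le> v \<Longrightarrow> 0 \<le> t \<Longrightarrow> ennpowr u t \<le> ennpowr v t"
  by (cases u; cases v)
    (auto simp: ennpowr_def ennreal_neq_top top_unique infinity_ennreal_def intro!: ennreal_leI powr_mono2)

text \<open>
  Telescoping: for every \<open>s > 0\<close>, small or large, \<open>n\<^sup>s - (n - 1)\<^sup>s\<close> is at least
  \<open>s / (1 + s)\<close> times \<open>n\<^sup>s / n\<close>, since
  \<open>(1 - 1 / n)\<^sup>s \<le> exp (- s / n) \<le> 1 / (1 + s / n)\<close>.
\<close>

lemma sum_power_upper:
  fixes s :: real
  assumes "s > 0"
  shows "(\<Sum>n<M. real (Suc n) powr s / real (Suc n)) \<le> (1 + s) / s * real M powr s"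
proof (induction M)
  case 0
  then show ?case by simp
next
  case (Suc M)
  define n where "n = real (Suc M)"
  have n: "n > 0" "real M = n - 1" "n \<ge> 1" by (auto simp: n_def)
  have "(n - 1) powr s \<le> (n * exp (- 1 / n)) powr s"
  proof (rule powr_mono2)
    have "1 + (- 1 / n) \<le> exp (- 1 / n)" by (rule exp_ge_add_one_self)
    then have "n * (1 + (- 1 / n)) \<le> n * exp (- 1 / n)" using n by (intro mult_left_mono) auto
    then show "n - 1 \<le> n * exp (- 1 / n)" using n by (simp add: algebra_simps)
  qed (use n assms in auto)
  also have "\<dots> = n powr s * exp (- (s / n))"
    using n by (simp add: powr_mult) (simp add: powr_def)
  also have "\<dots> \<le> n powr s * (1 / (1 + s / n))"
  proof (rule mult_left_mono)
    have "1 + s / n \<le> exp (s / n)" by (rule exp_ge_add_one_self)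
    moreover have "0 < 1 + s / n" using n assms by (simp add: add_pos_pos)
    ultimately show "exp (- (s / n)) \<le> 1 / (1 + s / n)"
      by (simp add: exp_minus divide_simps)
  qed simp
  also have "\<dots> \<le> n powr s * (1 - s / (1 + s) / n)"
  proof (rule mult_left_mono)
    show "1 / (1 + s / n) \<le> 1 - s / (1 + s) / n"
      using n assms by (simp add: divide_simps add_pos_pos) (simp add: algebra_simps)
  qed simp
  finally have "s / (1 + s) * (n powr s / n) \<le> n powr s - (n - 1) powr s"
    by (simp add: algebra_simps)
  then have "(1 + s) / s * (s / (1 + s) * (n powr s / n)) \<le> (1 + s) / s * (n powr s - (n - 1) powr s)"
    using assms by (intro mult_left_mono) auto
  moreover have "(1 + s) / s * (s / (1 + s) * (n powr s / n)) = n powr s / n" using assms by simp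
  ultimately have "n powr s / n \<le> (1 + s) / s * n powr s - (1 + s) / s * (n - 1) powr s"
    by (simp add: right_diff_distrib)
  with Suc.IH have "(\<Sum>n<M. real (Suc n) powr s / real (Suc n)) + n powr s / n \<le> (1 + s) / s * n powr s"
    unfolding n(2) by linarith
  then show ?case by (simp only: n_def sum.lessThan_Suc)
qed

text \<open>
  The opposite telescoping bound \<open>n\<^sup>s - (n - 1)\<^sup>s \<le> k n\<^sup>s / n\<close>, for an integer \<open>k \<ge> s\<close>, is
  Bernoulli's inequality for \<open>(1 - 1 / n)\<^sup>k\<close>.
\<close>

lemma sum_power_lower:
  fixes s :: real
  assumes "s > 0"
  obtains \<kappa> where "\<kappa> > 0"
    "\<And>M. \<kappa> * real M powr s \<le> (\<Sum>n<M. real (Suc n) powr s / real (Suc n))"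
proof
  define k where "k = nat \<lceil>s\<rceil>"
  have k: "real k \<ge> s" "k > 0" using assms by (auto simp: k_def) 
  show "1 / real k > 0" using k by simp
  fix M
  have "real M powr s \<le> real k * (\<Sum>n<M. real (Suc n) powr s / real (Suc n))"
  proof (induction M)
    case 0
    then show ?case by simp
  next
    case (Suc M)
    define n where "n = real (Suc M)"
    have n: "n > 0" "real M = n - 1" "n \<ge> 1" by (auto simp: n_def)
    define u where "u = 1 - 1 / n"
    have u: "0 \<le> u" "u \<le> 1" using n by (auto simp: u_def)
    have "1 - real k / n \<le> u powr s"
    proof (cases "u = 0")
      \<comment> \<open>The laws of real powers require \<open>u > 0\<close>; the remaining case is \<open>n = 1\<close>.\<close>
      case True
      then have "n = 1" using n by (simp add: u_def)
      with k True show ?thesis by simp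
    next
      case False
      have "1 + real k * (- (1 / n)) \<le> (1 + - (1 / n)) ^ k"
        using n by (intro Bernoulli_inequality) auto
      also have "1 + - (1 / n) = u" by (simp add: u_def)
      also have "u ^ k = u powr real k" using u False powr_realpow[of u k] by simp
      also have "\<dots> \<le> u powr s" using u False k by (intro powr_mono') auto
      finally show ?thesis by simp
    qed
    then have "n powr s * (1 - real k / n) \<le> n powr s * u powr s"
      by (intro mult_left_mono) auto
    also have "\<dots> = (n * u) powr s" using n u by (simp add: powr_mult)
    also have "n * u = n - 1" using n by (simp add: u_def algebra_simps)
    finally have "n powr s \<le> (n - 1) powr s + real k * (n powr s / n)"
      by (simp add: algebra_simps)
    with Suc.IH have "n powr s \<le> real k * ((\<Sum>n<M. real (Suc n) powr s / real (Suc n)) + n powr s / n)"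
      unfolding n(2) distrib_left by linarith
    then show ?case by (simp only: n_def sum.lessThan_Suc)
  qed
  then show "1 / real k * real M powr s \<le> (\<Sum>n<M. real (Suc n) powr s / real (Suc n))"
    using k by (simp add: divide_simps mult.commute)
qed

lemma suminf_step_le:
  fixes s b :: real
  assumes "s > 0" "b \<ge> 0"
  shows "(\<Sum>n. if Suc n \<le> M then ennreal (b * (real (Suc n) powr s / real (Suc n))) else 0)
         \<le> ennreal ((1 + s) / s * (b * real M powr s))" (is "suminf ?f \<le> _")
proof -
  have "suminf ?f = sum ?f {..<M}" by (rule suminf_finite) auto
  also have "\<dots> = (\<Sum>n<M. ennreal (b * (real (Suc n) powr s / real (Suc n))))"
    by (rule sum.cong) auto
  also have "\<dots> = ennreal (\<Sum>n<M. b * (real (Suc n) powr s / real (Suc n)))"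
    using assms by (subst sum_ennreal) auto
  also have "\<dots> = ennreal (b * (\<Sum>n<M. real (Suc n) powr s / real (Suc n)))"
    by (simp only: sum_distrib_left)
  also have "\<dots> \<le> ennreal (b * ((1 + s) / s * real M powr s))"
    using assms by (intro ennreal_leI mult_left_mono sum_power_upper) auto
  finally show ?thesis by (simp add: mult_ac)
qed

text \<open>
  The sequence is dominated by a function that is \<open>A\<close> up to \<open>Q\<close>, then \<open>B\<close> up to \<open>M\<close>, then
  zero.  By \<open>sum_power_upper\<close> with exponent \<open>\<alpha> \<tau>\<close> each step contributes to the
  norm, up to a constant factor, as if only its last index counted.  The constant depends on \<open>\<alpha>\<close> and \<open>\<tau>\<close> alone, which
  is why it is obtained before the sequence.
\<close>

lemma weighted_lseq_two_step_upper:
  fixes \<alpha> :: real and \<tau> :: ennreal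
  assumes "\<alpha> > 0" "\<tau> > 0"
  obtains K where "K > 0"
    "\<And>a A B Q M T. 0 \<le> A \<Longrightarrow> 0 \<le> B \<Longrightarrow> (\<And>N. N \<ge> 1 \<Longrightarrow> a N \<le> ennreal A) \<Longrightarrow>
       (\<And>N. N \<ge> Q \<Longrightarrow> a N \<le> ennreal B) \<Longrightarrow> (\<And>N. N > M \<Longrightarrow> a N = 0) \<Longrightarrow>
       real Q powr \<alpha> * A \<le> T \<Longrightarrow> real M powr \<alpha> * B \<le> T \<Longrightarrow>
       weighted_lseq \<alpha> \<tau> a \<le> ennreal (K * T)"
proof (cases "\<tau> = \<infinity>")
  case True
  show ?thesis
  proof (rule that[of 1])
    fix a :: "nat \<Rightarrow> ennreal" and A B T :: real and Q M :: nat
    assume *: "0 \<le> A" "0 \<le> B" "\<And>N. N \<ge> 1 \<Longrightarrow> a N \<le> ennreal A"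
       "\<And>N. N \<ge> Q \<Longrightarrow> a N \<le> ennreal B" "\<And>N. N > M \<Longrightarrow> a N = 0"
       "real Q powr \<alpha> * A \<le> T" "real M powr \<alpha> * B \<le> T"
    have "ennreal (real N powr \<alpha>) * a N \<le> ennreal T" if N: "N \<ge> 1" for N
    proof -
      consider "N \<le> Q" | "N \<ge> Q" "N \<le> M" | "N > M" by linarith
      then show ?thesis
      proof cases
        case 1
        have "ennreal (real N powr \<alpha>) * a N \<le> ennreal (real Q powr \<alpha>) * ennreal A"
          using 1 assms by (intro mult_mono * N ennreal_leI powr_mono2) auto
        also have "\<dots> = ennreal (real Q powr \<alpha> * A)" using * by (simp add: ennreal_mult'')
        also have "\<dots> \<le> ennreal T" by (intro ennreal_leI *)
        finally show ?thesis .
      next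
        case 2
        have "ennreal (real N powr \<alpha>) * a N \<le> ennreal (real M powr \<alpha>) * ennreal B"
          using 2 assms by (intro mult_mono * N ennreal_leI powr_mono2) auto
        also have "\<dots> = ennreal (real M powr \<alpha> * B)" using * by (simp add: ennreal_mult'')
        also have "\<dots> \<le> ennreal T" by (intro ennreal_leI *)
        finally show ?thesis .
      next
        case 3
        then show ?thesis using * by simp
      qed
    qed
    then show "weighted_lseq \<alpha> \<tau> a \<le> ennreal (1 * T)"
      using True by (auto simp: weighted_lseq_def intro!: SUP_least)
  qed simp
next
  case False
  define t where "t = enn2real \<tau>"
  have t: "t > 0" using False assms by (simp add: t_def enn2real_positive_iff less_top)
  define s where "s = \<alpha> * t"
  have s: "s > 0" using t assms by (simp add: s_def)
  define K where "K = (2 * ((1 + s) / s)) powr (1 / t)"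
  show ?thesis
  proof (rule that[of K])
    show "K > 0" using s by (simp add: K_def)
    fix a :: "nat \<Rightarrow> ennreal" and A B T :: real and Q M :: nat
    assume *: "0 \<le> A" "0 \<le> B" "\<And>N. N \<ge> 1 \<Longrightarrow> a N \<le> ennreal A"
       "\<And>N. N \<ge> Q \<Longrightarrow> a N \<le> ennreal B" "\<And>N. N > M \<Longrightarrow> a N = 0"
       "real Q powr \<alpha> * A \<le> T" "real M powr \<alpha> * B \<le> T"
    have T: "T \<ge> 0" by (rule order_trans[OF _ *(6)]) (use * in auto)
    define f where "f n = ennpowr (ennreal (real (Suc n) powr \<alpha>) * a (Suc n)) t
              * ennreal (1 / real (Suc n))" for n
    define g where "g b M n = (if Suc n \<le> M
        then ennreal (b powr t * (real (Suc n) powr s / real (Suc n))) else 0)" for b M n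
    have term_le: "f n \<le> ennreal (b powr t * (real (Suc n) powr s / real (Suc n)))"
      if "a (Suc n) \<le> ennreal b" "b \<ge> 0" for b n
    proof -
      have "f n \<le> ennpowr (ennreal (real (Suc n) powr \<alpha>) * ennreal b) t * ennreal (1 / real (Suc n))"
        unfolding f_def using that t by (intro mult_right_mono ennpowr_mono mult_left_mono) auto
      also have "\<dots> = ennreal ((real (Suc n) powr \<alpha> * b) powr t * (1 / real (Suc n)))"
        using that by (simp add: ennreal_mult''[symmetric] ennpowr_ennreal del: of_nat_Suc)
      also have "(real (Suc n) powr \<alpha> * b) powr t * (1 / real (Suc n))
           = b powr t * (real (Suc n) powr s / real (Suc n))"
        using that by (simp add: powr_mult powr_powr s_def del: of_nat_Suc)
      finally show ?thesis .
    qed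
    have "f n \<le> g A Q n + g B M n" for n
    proof -
      consider "Suc n \<le> Q" | "Suc n \<ge> Q" "Suc n \<le> M" | "Suc n > M" by linarith
      then show ?thesis
      proof cases
        case 1
        then have "f n \<le> g A Q n" using term_le[of n A] * by (simp add: g_def)
        then show ?thesis by (simp add: add_increasing2)
      next
        case 2
        then have "f n \<le> g B M n" using term_le[of n B] * by (simp add: g_def)
        then show ?thesis by (simp add: add_increasing)
      next
        case 3
        then show ?thesis using * t by (simp add: f_def ennpowr_def)
      qed
    qed
    then have "suminf f \<le> (\<Sum>n. g A Q n + g B M n)" by (intro suminf_le) auto
    also have "\<dots> = suminf (g A Q) + suminf (g B M)" by (rule suminf_add[symmetric]) auto
    also have "\<dots> \<le> ennreal ((1 + s) / s * (A powr t * real Q powr s))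
                 + ennreal ((1 + s) / s * (B powr t * real M powr s))"
      unfolding g_def by (intro add_mono suminf_step_le s) auto
    also have "\<dots> \<le> ennreal ((1 + s) / s * T powr t) + ennreal ((1 + s) / s * T powr t)"
    proof -
      have "A powr t * real Q powr s = (real Q powr \<alpha> * A) powr t"
        "B powr t * real M powr s = (real M powr \<alpha> * B) powr t"
        using * by (auto simp: powr_mult powr_powr s_def)
      then show ?thesis using * t s
        by (intro add_mono ennreal_leI mult_left_mono) (auto intro!: powr_mono2)
    qed
    also have "\<dots> = ennreal (2 * ((1 + s) / s) * T powr t)"
      using s by (simp flip: ennreal_plus)
    finally have "ennpowr (suminf f) (1 / t) \<le> ennpowr (ennreal (2 * ((1 + s) / s) * T powr t)) (1 / t)"
      using t by (intro ennpowr_mono) auto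
    also have "\<dots> = ennreal ((2 * ((1 + s) / s) * T powr t) powr (1 / t))"
      using s by (intro ennpowr_ennreal) auto
    also have "(2 * ((1 + s) / s) * T powr t) powr (1 / t) = K * T"
      unfolding K_def using s t T by (simp only: powr_mult powr_powr) simp
    finally show "weighted_lseq \<alpha> \<tau> a \<le> ennreal (K * T)"
      using False by (simp add: weighted_lseq_def f_def[abs_def] t_def[symmetric] del: of_nat_Suc)
  qed
qed

text \<open>
  The companion of \<open>weighted_lseq_two_step_upper\<close>: a single step of height \<open>R\<close> and length
  \<open>m\<close> already has norm comparable to \<open>m\<^sup>\<alpha> R\<close>.
\<close>

lemma weighted_lseq_step_lower:
  fixes \<alpha> :: real and \<tau> :: ennreal
  assumes "\<alpha> > 0" "\<tau> > 0"
  obtains \<kappa> where "\<kappa> > 0"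
    "\<And>a R m. 0 \<le> R \<Longrightarrow> (\<And>N. N \<le> m \<Longrightarrow> ennreal R \<le> a N) \<Longrightarrow>
       ennreal (\<kappa> * (real m powr \<alpha> * R)) \<le> weighted_lseq \<alpha> \<tau> a"
proof (cases "\<tau> = \<infinity>")
  case True
  show ?thesis
  proof (rule that[of 1])
    fix a :: "nat \<Rightarrow> ennreal" and R :: real and m :: nat
    assume *: "0 \<le> R" "\<And>N. N \<le> m \<Longrightarrow> ennreal R \<le> a N"
    show "ennreal (1 * (real m powr \<alpha> * R)) \<le> weighted_lseq \<alpha> \<tau> a"
    proof (cases "m = 0")
      case False
      have "ennreal (1 * (real m powr \<alpha> * R)) = ennreal (real m powr \<alpha>) * ennreal R"
        using * by (simp add: ennreal_mult)
      also have "\<dots> \<le> ennreal (real m powr \<alpha>) * a m" by (intro mult_left_mono *) auto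
      also have "\<dots> \<le> (SUP N\<in>{1..}. ennreal (real N powr \<alpha>) * a N)"
        using False by (intro SUP_upper) auto
      finally show ?thesis using True by (simp add: weighted_lseq_def)
    qed simp
  qed simp
next
  case False
  define t where "t = enn2real \<tau>"
  have t: "t > 0" using False assms by (simp add: t_def enn2real_positive_iff less_top)
  define s where "s = \<alpha> * t"
  have s: "s > 0" using t assms by (simp add: s_def)
  obtain k where k: "k > 0" "\<And>M. k * real M powr s \<le> (\<Sum>n<M. real (Suc n) powr s / real (Suc n))"
    using sum_power_lower[OF s] by blast
  show ?thesis
  proof (rule that[of "k powr (1 / t)"])
    show "k powr (1 / t) > 0" using k by simp
    fix a :: "nat \<Rightarrow> ennreal" and R :: real and m :: nat
    assume *: "0 \<le> R" "\<And>N. N \<le> m \<Longrightarrow> ennreal R \<le> a N"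
    define f where "f n = ennpowr (ennreal (real (Suc n) powr \<alpha>) * a (Suc n)) t
              * ennreal (1 / real (Suc n))" for n
    have term_ge: "ennreal (R powr t * (real (Suc n) powr s / real (Suc n))) \<le> f n"
      if "n < m" for n
    proof -
      have "R powr t * (real (Suc n) powr s / real (Suc n))
          = (real (Suc n) powr \<alpha> * R) powr t * (1 / real (Suc n))"
        using * by (simp add: powr_mult powr_powr s_def del: of_nat_Suc)
      also have "ennreal \<dots> = ennpowr (ennreal (real (Suc n) powr \<alpha>) * ennreal R) t * ennreal (1 / real (Suc n))"
        using * by (simp add: ennreal_mult''[symmetric] ennpowr_ennreal del: of_nat_Suc)
      also have "\<dots> \<le> f n"
        unfolding f_def using that t by (intro mult_right_mono ennpowr_mono mult_left_mono *) auto
      finally show ?thesis .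
    qed
    have "ennreal (R powr t * (k * real m powr s))
        \<le> ennreal (R powr t * (\<Sum>n<m. real (Suc n) powr s / real (Suc n)))"
      using k by (intro ennreal_leI mult_left_mono) auto
    also have "\<dots> = (\<Sum>n<m. ennreal (R powr t * (real (Suc n) powr s / real (Suc n))))"
      by (subst sum_ennreal) (auto simp: sum_distrib_left)
    also have "\<dots> \<le> sum f {..<m}" by (intro sum_mono term_ge) auto
    also have "\<dots> \<le> suminf f" by (rule sum_le_suminf) auto
    finally have "ennpowr (ennreal (R powr t * (k * real m powr s))) (1 / t) \<le> ennpowr (suminf f) (1 / t)"
      using t by (intro ennpowr_mono) auto
    moreover have "(R powr t * (k * real m powr s)) powr (1 / t) = k powr (1 / t) * (real m powr \<alpha> * R)"
      using s t k * by (simp add: powr_mult powr_powr s_def)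
    ultimately have "ennreal (k powr (1 / t) * (real m powr \<alpha> * R)) \<le> ennpowr (suminf f) (1 / t)"
      using k by (simp add: ennpowr_ennreal)
    then show "ennreal (k powr (1 / t) * (real m powr \<alpha> * R)) \<le> weighted_lseq \<alpha> \<tau> a"
      using False by (simp add: weighted_lseq_def f_def[abs_def] t_def[symmetric] del: of_nat_Suc)
  qed
qed

section \<open>Indicator vectors of finite sets in a quasi-Banach space\<close>

context quasi_banach
begin

lemma nrm_0: "nrm 0 = 0"
  by (simp add: nrm_eq_0_iff)

lemma quasi_triangle: "nrm (x + y) \<le> 2 powr (1 / \<rho>) * max (nrm x) (nrm y)"
proof -
  define M where "M = max (nrm x) (nrm y)"
  have M: "0 \<le> M" using nrm_nonneg[of x] by (simp add: M_def)
  have "nrm x powr \<rho> \<le> M powr \<rho>" "nrm y powr \<rho> \<le> M powr \<rho>"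
    using rho_pos nrm_nonneg by (auto simp: M_def intro!: powr_mono2)
  then have "nrm (x + y) powr \<rho> \<le> 2 * M powr \<rho>"
    using nrm_triangle[of x y] by linarith
  then have "(nrm (x + y) powr \<rho>) powr (1 / \<rho>) \<le> (2 * M powr \<rho>) powr (1 / \<rho>)"
    using rho_pos by (intro powr_mono2) auto
  then show ?thesis
    using rho_pos nrm_nonneg M by (simp add: powr_powr powr_mult M_def)
qed

lemma sum_smul_of_bool:
  assumes "finite \<Gamma>" "finite A"
  shows "(\<Sum>j\<in>A. smul (of_bool (j \<in> \<Gamma>)) (e j)) = sum e (A \<inter> \<Gamma>)"
proof -
  have "(\<Sum>j\<in>A. smul (of_bool (j \<in> \<Gamma>)) (e j)) = (\<Sum>j\<in>A. if j \<in> \<Gamma> then e j else 0)"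
    by (rule sum.cong) auto
  also have "\<dots> = sum e (A \<inter> \<Gamma>)" using assms by (simp add: sum.inter_restrict)
  finally show ?thesis .
qed

lemma eventually_partial_sum_eq:
  assumes "finite \<Gamma>"
  shows "\<forall>\<^sub>F n in sequentially. (\<Sum>j<n. smul (of_bool (j \<in> \<Gamma>)) (e j)) = sum e \<Gamma>"
proof -
  obtain m where m: "\<Gamma> \<subseteq> {..<m}" using assms finite_nat_iff_bounded by blast
  have "(\<Sum>j<n. smul (of_bool (j \<in> \<Gamma>)) (e j)) = sum e \<Gamma>" if "n \<ge> m" for n
  proof -
    have "{..<n} \<inter> \<Gamma> = \<Gamma>" using m that by auto
    then show ?thesis using assms by (simp add: sum_smul_of_bool)
  qed
  then show ?thesis unfolding eventually_sequentially by blast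
qed

text \<open>
  The partial sums are eventually constant, so convergence forces equality.  The equivalence
  identifies both the coefficients of an indicator vector and the vector that
  unconditionality produces from it.
\<close>

lemma has_expansion_sum_iff:
  assumes "finite \<Gamma>"
  shows "has_expansion smul nrm e x (\<lambda>j. of_bool (j \<in> \<Gamma>)) \<longleftrightarrow> x = sum e \<Gamma>"
proof -
  have "has_expansion smul nrm e x (\<lambda>j. of_bool (j \<in> \<Gamma>))
     \<longleftrightarrow> (\<lambda>n::nat. nrm (x - sum e \<Gamma>)) \<longlonglongrightarrow> 0"
    unfolding has_expansion_def
    by (intro filterlim_cong refl eventually_mono[OF eventually_partial_sum_eq[OF assms, of e]]) simp
  also have "\<dots> \<longleftrightarrow> nrm (x - sum e \<Gamma>) = 0" by (simp add: LIMSEQ_const_iff)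
  finally show ?thesis by (simp add: nrm_eq_0_iff)
qed

lemma basis_coeff_sum:
  assumes "is_basis smul nrm e" "finite \<Gamma>"
  shows "basis_coeff smul nrm e (sum e \<Gamma>) j = of_bool (j \<in> \<Gamma>)"
proof -
  have "basis_coeff smul nrm e (sum e \<Gamma>) = (\<lambda>j. of_bool (j \<in> \<Gamma>))"
    unfolding basis_coeff_def
    using assms has_expansion_sum_iff[of \<Gamma> e "sum e \<Gamma>"] unfolding is_basis_def
    by (intro the1_equality) auto
  then show ?thesis by simp
qed

text \<open>
  The multipliers with values 0 and 1 that single out \<open>\<Gamma>\<close> map the indicator of \<open>\<Delta>\<close> to the
  indicator of \<open>\<Gamma>\<close>.
\<close>

lemma nrm_sum_mono:
  assumes "unconditional_basis smul nrm e 1" "finite \<Delta>" "\<Gamma> \<subseteq> \<Delta>"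
  shows "nrm (sum e \<Gamma>) \<le> nrm (sum e \<Delta>)"
proof -
  have \<Gamma>: "finite \<Gamma>" using assms finite_subset by blast
  have "has_expansion smul nrm e (sum e \<Delta>) (\<lambda>j. of_bool (j \<in> \<Delta>))"
    using assms by (simp add: has_expansion_sum_iff)
  then obtain y where "has_expansion smul nrm e y (\<lambda>j. of_bool (j \<in> \<Gamma>) * of_bool (j \<in> \<Delta>))"
    and y: "nrm y \<le> 1 * nrm (sum e \<Delta>)"
    using assms(1)[unfolded unconditional_basis_def, THEN conjunct2, rule_format,
        of "sum e \<Delta>" "\<lambda>j. of_bool (j \<in> \<Delta>)" "\<lambda>j. of_bool (j \<in> \<Gamma>)"]
    by (force simp: of_bool_def)
  moreover have "(\<lambda>j. of_bool (j \<in> \<Gamma>) * of_bool (j \<in> \<Delta>) :: 'k) = (\<lambda>j. of_bool (j \<in> \<Gamma>))"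
    by (intro ext) (use assms(3) in auto)
  ultimately have "y = sum e \<Gamma>" using \<Gamma> by (simp add: has_expansion_sum_iff)
  with y show ?thesis by simp
qed

section \<open>Approximation errors of indicator vectors\<close>

lemma sigma_err_sum_le:
  assumes "is_basis smul nrm e" "finite \<Delta>" "\<Gamma> \<subseteq> \<Delta>" "card \<Gamma> \<le> N"
  shows "sigma_err smul nrm e (sum e \<Delta>) N \<le> ennreal (nrm (sum e (\<Delta> - \<Gamma>)))"
proof -
  have \<Gamma>: "finite \<Gamma>" using assms finite_subset by blast
  have "sum e \<Gamma> \<in> sparse_set smul nrm e N"
    using assms \<Gamma> by (simp add: sparse_set_def basis_coeff_sum)
  then have "sigma_err smul nrm e (sum e \<Delta>) N \<le> ennreal (nrm (sum e \<Delta> - sum e \<Gamma>))"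
    unfolding sigma_err_def by (rule INF_lower)
  also have "sum e \<Delta> - sum e \<Gamma> = sum e (\<Delta> - \<Gamma>)"
    using assms by (simp add: sum_diff)
  finally show ?thesis .
qed

text \<open>
  Such a bijection is a greedy ordering for the indicator of \<open>\<Delta>\<close> that lists \<open>\<Gamma>\<close> first.  It is
  glued from enumerations of \<open>\<Gamma>\<close>, of \<open>\<Delta> - \<Gamma>\<close> and of the infinite complement of \<open>\<Delta>\<close>.
\<close>

lemma ex_bij_prefix_images:
  fixes \<Gamma> \<Delta> :: "nat set"
  assumes "finite \<Delta>" "\<Gamma> \<subseteq> \<Delta>"
  obtains \<pi> :: "nat \<Rightarrow> nat" where "bij \<pi>" "\<pi> ` {..<card \<Gamma>} = \<Gamma>" "\<pi> ` {..<card \<Delta>} = \<Delta>"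
proof -
  have \<Gamma>: "finite \<Gamma>" using assms finite_subset by blast
  have c: "card (\<Delta> - \<Gamma>) = card \<Delta> - card \<Gamma>" "card \<Gamma> \<le> card \<Delta>"
    using assms \<Gamma> by (auto simp: card_Diff_subset card_mono)
  have "\<exists>f. bij_betw f {..<card \<Gamma>} \<Gamma>"
    using \<Gamma> by (intro finite_same_card_bij) auto
  moreover have "\<exists>g. bij_betw g {card \<Gamma>..<card \<Delta>} (\<Delta> - \<Gamma>)"
    using assms c by (intro finite_same_card_bij) auto
  moreover have "\<exists>h :: nat \<Rightarrow> nat. bij_betw h {card \<Delta>..} (- \<Delta>)"
  proof -
    have inf: "infinite (- \<Delta>)" using assms by (simp add: finite_compl)
    have "bij_betw (\<lambda>n. n - card \<Delta>) {card \<Delta>..} UNIV"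
      by (rule bij_betw_byWitness[where f' = "\<lambda>n. n + card \<Delta>"]) auto
    from bij_betw_trans[OF this bij_enumerate[OF inf]] show ?thesis by blast
  qed
  ultimately obtain f g h where f: "bij_betw f {..<card \<Gamma>} \<Gamma>"
    and g: "bij_betw g {card \<Gamma>..<card \<Delta>} (\<Delta> - \<Gamma>)" and h: "bij_betw h {card \<Delta>..} (- \<Delta>)" by blast
  define p1 where "p1 = (\<lambda>n. if n \<in> {..<card \<Gamma>} then f n else g n)"
  define p where "p = (\<lambda>n. if n \<in> {..<card \<Delta>} then p1 n else h n)"
  have p1: "bij_betw p1 ({..<card \<Gamma>} \<union> {card \<Gamma>..<card \<Delta>}) (\<Gamma> \<union> (\<Delta> - \<Gamma>))"
    unfolding p1_def by (rule bij_betw_disjoint_Un[OF f g]) auto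
  also have "{..<card \<Gamma>} \<union> {card \<Gamma>..<card \<Delta>} = {..<card \<Delta>}" using c by auto
  also have "\<Gamma> \<union> (\<Delta> - \<Gamma>) = \<Delta>" using assms by auto
  finally have p1: "bij_betw p1 {..<card \<Delta>} \<Delta>" .
  have "bij_betw p ({..<card \<Delta>} \<union> {card \<Delta>..}) (\<Delta> \<union> - \<Delta>)"
    unfolding p_def by (rule bij_betw_disjoint_Un[OF p1 h]) auto
  also have "{..<card \<Delta>} \<union> {card \<Delta>..} = UNIV" by auto
  finally have "bij p" by simp
  moreover have "p ` {..<card \<Gamma>} = f ` {..<card \<Gamma>}"
    using c by (intro image_cong) (auto simp: p_def p1_def)
  moreover have "p ` {..<card \<Delta>} = p1 ` {..<card \<Delta>}"
    by (intro image_cong) (auto simp: p_def)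
  ultimately show ?thesis using that f p1 by (metis bij_betw_imp_surj_on)
qed

text \<open>
  Along the ordering that lists \<open>\<Gamma>\<close> first, the first \<open>N\<close> greedy steps remove only elements of
  \<open>\<Gamma>\<close>, so the remainder still contains all of \<open>\<Delta> - \<Gamma>\<close>, and its quasi-norm can only be larger.
\<close>

lemma gamma_err_sum_ge:
  assumes "unconditional_basis smul nrm e 1" "finite \<Delta>" "\<Gamma> \<subseteq> \<Delta>" "N \<le> card \<Gamma>"
  shows "ennreal (nrm (sum e (\<Delta> - \<Gamma>))) \<le> gamma_err smul nrm e (sum e \<Delta>) N"
proof -
  have basis: "is_basis smul nrm e" using assms by (simp add: unconditional_basis_def)
  note coeff = basis_coeff_sum[OF basis assms(2)]
  obtain \<pi> where \<pi>: "bij \<pi>" "\<pi> ` {..<card \<Gamma>} = \<Gamma>" "\<pi> ` {..<card \<Delta>} = \<Delta>"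
    using ex_bij_prefix_images assms by metis
  have inj: "inj \<pi>" using \<pi>(1) by (rule bij_is_inj)
  have mem: "\<pi> j \<in> \<Delta> \<longleftrightarrow> j < card \<Delta>" for j
    using inj_image_mem_iff[OF inj, of j "{..<card \<Delta>}"] \<pi>(3) by simp
  have greedy: "\<pi> \<in> greedy_orderings smul nrm e (sum e \<Delta>)"
    using \<pi>(1) by (auto simp: greedy_orderings_def coeff mem)
  define A where "A = \<pi> ` {..<N}"
  have A: "A \<subseteq> \<Gamma>" using \<pi>(2) assms(4) unfolding A_def by force
  have "greedy_sum smul nrm e \<pi> N (sum e \<Delta>) = (\<Sum>j\<in>A. smul (of_bool (j \<in> \<Delta>)) (e j))"
    unfolding greedy_sum_def coeff A_def
    using inj by (subst sum.reindex) (auto intro: inj_on_subset)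
  also have "\<dots> = sum e A"
    using A assms by (subst sum_smul_of_bool) (auto simp: A_def Int_absorb2)
  finally have "sum e \<Delta> - greedy_sum smul nrm e \<pi> N (sum e \<Delta>) = sum e (\<Delta> - A)"
    using A assms by (simp add: sum_diff)
  moreover have "nrm (sum e (\<Delta> - \<Gamma>)) \<le> nrm (sum e (\<Delta> - A))"
    using A assms by (intro nrm_sum_mono) auto
  ultimately have "ennreal (nrm (sum e (\<Delta> - \<Gamma>)))
      \<le> ennreal (nrm (sum e \<Delta> - greedy_sum smul nrm e \<pi> N (sum e \<Delta>)))"
    by (simp add: ennreal_leI)
  also have "\<dots> \<le> gamma_err smul nrm e (sum e \<Delta>) N"
    unfolding gamma_err_def by (rule SUP_upper[OF greedy])
  finally show ?thesis .
qed

end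

section \<open>Failure of the inclusion\<close>

theorem proposition7p1:
  fixes smul :: "'k::real_normed_field \<Rightarrow> 'b::ab_group_add \<Rightarrow> 'b"
    and nrm :: "'b \<Rightarrow> real" and \<rho> :: real
    and e :: "nat \<Rightarrow> 'b"
    and \<alpha> :: real
    and p q :: "nat \<Rightarrow> nat"
  assumes "quasi_banach smul nrm \<rho>"
    and "unconditional_basis smul nrm e 1"
    and "\<And>j. nrm (e j) = 1"
    and "\<alpha> > 0"
    and "\<And>N. N \<ge> 1 \<Longrightarrow> p N \<ge> q N \<and> q N \<ge> 1"
    and "filterlim (\<lambda>N. real (p N) / real (q N)) at_top sequentially"
    and "\<exists>c>0. \<forall>N\<ge>1. democracy_upper nrm e (q N) / democracy_lower nrm e (p N)
                        \<ge> c * (real (p N) / real (q N)) powr \<alpha>"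
  shows "\<forall>\<tau>::ennreal. \<tau> > 0 \<longrightarrow>
           \<not> continuously_included
               (approx_space smul nrm e \<alpha> \<tau>) (approx_norm smul nrm e \<alpha> \<tau>)
               (greedy_class smul nrm e \<alpha> \<tau>) (greedy_norm smul nrm e \<alpha> \<tau>)"
proof (intro allI impI notI)
  fix \<tau> :: ennreal
  assume \<tau>: "\<tau> > 0"
  assume "continuously_included
               (approx_space smul nrm e \<alpha> \<tau>) (approx_norm smul nrm e \<alpha> \<tau>)
               (greedy_class smul nrm e \<alpha> \<tau>) (greedy_norm smul nrm e \<alpha> \<tau>)"
  then obtain C :: real where C: "C > 0"
    "\<And>x. approx_norm smul nrm e \<alpha> \<tau> x < \<infinity> \<Longrightarrow>
       greedy_norm smul nrm e \<alpha> \<tau> x \<le> ennreal C * approx_norm smul nrm e \<alpha> \<tau> x"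
    by (auto simp: continuously_included_def approx_space_def)
  interpret quasi_banach smul nrm \<rho> by fact
  note unc = assms(2) and \<alpha> = assms(4)
  have basis: "is_basis smul nrm e" using unc by (simp add: unconditional_basis_def)
  obtain c where c: "c > 0" "\<And>N. N \<ge> 1 \<Longrightarrow>
      democracy_upper nrm e (q N) / democracy_lower nrm e (p N) \<ge> c * (real (p N) / real (q N)) powr \<alpha>"
    using assms(7) by auto
  obtain K where K: "K > 0"
    "\<And>a A B Q M T. 0 \<le> A \<Longrightarrow> 0 \<le> B \<Longrightarrow> (\<And>N. N \<ge> 1 \<Longrightarrow> a N \<le> ennreal A) \<Longrightarrow>
       (\<And>N. N \<ge> Q \<Longrightarrow> a N \<le> ennreal B) \<Longrightarrow> (\<And>N. N > M \<Longrightarrow> a N = 0) \<Longrightarrow>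
       real Q powr \<alpha> * A \<le> T \<Longrightarrow> real M powr \<alpha> * B \<le> T \<Longrightarrow>
       weighted_lseq \<alpha> \<tau> a \<le> ennreal (K * T)"
    using weighted_lseq_two_step_upper[OF \<alpha> \<tau>] by blast
  obtain \<kappa> where \<kappa>: "\<kappa> > 0"
    "\<And>a R m. 0 \<le> R \<Longrightarrow> (\<And>N. N \<le> m \<Longrightarrow> ennreal R \<le> a N) \<Longrightarrow>
       ennreal (\<kappa> * (real m powr \<alpha> * R)) \<le> weighted_lseq \<alpha> \<tau> a"
    using weighted_lseq_step_lower[OF \<alpha> \<tau>] by blast
  \<comment> \<open>\<open>D * R\<close> will bound \<open>nrm x\<close>, the factor \<open>2 powr (1 / \<rho>)\<close> being the price of the
    quasi-triangle inequality; \<open>F\<close> absorbs both steps of the approximation error; \<open>B\<close> is the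
    bound on \<open>(p / q) powr \<alpha>\<close> that a continuous inclusion with constant \<open>C\<close> would force.\<close>
  define D where "D = 2 powr (1 / \<rho>) * (1 + 4 / c)"
  define F where "F = D + 2 powr \<alpha> * (4 / c)"
  have D: "D > 0" using c by (auto simp: D_def intro!: mult_pos_pos add_pos_pos)
  have F: "F > 0" "D \<le> F" "2 powr \<alpha> * (4 / c) \<le> F" using D c by (auto simp: F_def add_pos_nonneg)
  define B where "B = C * (1 + K) * F * 2 powr \<alpha> / \<kappa>"
  have B: "B > 0" using C K F \<kappa> by (simp add: B_def add_pos_pos)

  obtain N where N: "N \<ge> 1" "real (p N) / real (q N) \<ge> max 2 (B powr (1 / \<alpha>) + 1)"
  proof -
    have "\<forall>\<^sub>F N in sequentially. real (p N) / real (q N) \<ge> max 2 (B powr (1 / \<alpha>) + 1)"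
      using assms(6) unfolding filterlim_at_top by blast
    then have "\<forall>\<^sub>F N in sequentially. N \<ge> 1 \<and> real (p N) / real (q N) \<ge> max 2 (B powr (1 / \<alpha>) + 1)"
      using eventually_ge_at_top[of 1] by eventually_elim auto
    then show ?thesis using that eventually_happens[of _ sequentially] by auto
  qed
  define P Q where "P = p N" and "Q = q N"
  have Q1: "Q \<ge> 1" using assms(5)[OF N(1)] by (simp add: Q_def)
  have r: "real P / real Q \<ge> 2" "real P / real Q > B powr (1 / \<alpha>)"
    using N(2) by (auto simp: P_def Q_def)
  have PQ: "real P \<ge> 2 * real Q" using r(1) Q1 by (simp add: field_simps)

  \<comment> \<open>The quotient of the democracy values is positive and the lower one is nonnegative, so both
    are positive, and sets extremal up to a factor 2 exist.\<close>
  define U L where "U = democracy_upper nrm e Q" and "L = democracy_lower nrm e P"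
  define S where "S n = {\<Gamma>::nat set. finite \<Gamma> \<and> card \<Gamma> = n}" for n
  have S_ne: "S n \<noteq> {}" for n by (auto simp: S_def intro!: exI[of _ "{..<n}"])
  have UL: "U / L \<ge> c * (real P / real Q) powr \<alpha>"
    using c(2)[OF N(1)] by (simp add: U_def L_def P_def Q_def)
  moreover have "c * (real P / real Q) powr \<alpha> > 0" using c Q1 PQ by simp
  ultimately have "U / L > 0" by linarith
  moreover have "L \<ge> 0"
    unfolding L_def democracy_lower_def using S_ne[of P] nrm_nonneg
    by (intro cINF_greatest) (auto simp: S_def)
  ultimately have pos: "U > 0" "L > 0" by (auto simp: zero_less_divide_iff)
  have UL': "c * (real P / real Q) powr \<alpha> * L \<le> U" using UL pos by (simp add: field_simps)
  obtain Gr where Gr: "finite Gr" "card Gr = Q" "U / 2 < nrm (sum e Gr)"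
  proof -
    have "U / 2 < (SUP \<Gamma>\<in>S Q. nrm (sum e \<Gamma>))"
      using pos by (simp add: U_def democracy_upper_def S_def)
    from less_cSupD[OF _ this] S_ne[of Q] obtain \<Gamma> where "\<Gamma> \<in> S Q" "U / 2 < nrm (sum e \<Gamma>)"
      by auto
    then show ?thesis by (intro that[of \<Gamma>]) (simp_all add: S_def)
  qed
  obtain Gl where Gl: "finite Gl" "card Gl = P" "nrm (sum e Gl) < 2 * L"
  proof -
    have "(INF \<Gamma>\<in>S P. nrm (sum e \<Gamma>)) < 2 * L"
      using pos by (simp add: L_def democracy_lower_def S_def)
    from cInf_lessD[OF _ this] S_ne[of P] obtain \<Gamma> where "\<Gamma> \<in> S P" "nrm (sum e \<Gamma>) < 2 * L"
      by auto
    then show ?thesis by (intro that[of \<Gamma>]) (simp_all add: S_def)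
  qed

  define \<Delta> where "\<Delta> = Gl \<union> Gr"
  define x where "x = sum e \<Delta>"
  define R where "R = nrm (sum e Gr)"
  define l where "l = nrm (sum e (Gl - Gr))"
  have \<Delta>: "finite \<Delta>" "Gr \<subseteq> \<Delta>" "Gl - Gr \<subseteq> \<Delta>" "\<Delta> - (Gl - Gr) = Gr" "\<Delta> - Gr = Gl - Gr"
    using Gr Gl by (auto simp: \<Delta>_def)
  have R: "R > 0" using Gr pos by (simp add: R_def)
  have l: "0 \<le> l" "l < 2 * L"
    using nrm_nonneg nrm_sum_mono[OF unc Gl(1), of "Gl - Gr"] Gl by (auto simp: l_def)
  \<comment> \<open>The hypothesis on the democracy functions, transferred to the chosen sets: the factor 4
    collects the two factors 2 lost in choosing them.\<close>
  have lR: "real P powr \<alpha> * l \<le> 4 / c * (real Q powr \<alpha> * R)"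
  proof -
    have "c * (real P / real Q) powr \<alpha> * l \<le> c * (real P / real Q) powr \<alpha> * (2 * L)"
      using l c by (intro mult_left_mono) auto
    also have "\<dots> \<le> 4 * R" using UL' Gr(3) by (simp add: R_def mult_ac)
    also have "(real P / real Q) powr \<alpha> = real P powr \<alpha> / real Q powr \<alpha>" by (simp add: powr_divide)
    finally have "c * (real P powr \<alpha> * l) \<le> 4 * (real Q powr \<alpha> * R)"
      using Q1 by (simp add: divide_le_eq mult_ac)
    then show ?thesis using c by (simp add: le_divide_eq mult_ac)
  qed
  have card_l: "real (card (Gl - Gr)) \<ge> real P / 2"
  proof -
    have "card Gl - card Gr \<le> card (Gl - Gr)" by (rule diff_card_le_card_Diff[OF Gr(1)])
    then show ?thesis using Gl Gr PQ by linarith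
  qed
  \<comment> \<open>Since \<open>Q \<le> P\<close>, \<open>lR\<close> also bounds \<open>l\<close> itself by a multiple of \<open>R\<close>.\<close>
  have xR: "nrm x \<le> D * R"
  proof -
    have "real Q powr \<alpha> * l \<le> real P powr \<alpha> * l"
      using PQ l \<alpha> by (intro mult_right_mono powr_mono2) auto
    with lR have "real Q powr \<alpha> * l \<le> real Q powr \<alpha> * (4 / c * R)" by (simp add: mult_ac)
    moreover have "real Q powr \<alpha> > 0" using Q1 by simp
    ultimately have "l \<le> 4 / c * R" by (rule mult_left_le_imp_le)
    moreover have "0 \<le> 4 / c * R" using c R by simp
    ultimately have max_le: "max R l \<le> (1 + 4 / c) * R"
      unfolding distrib_right using R by linarith
    have "x = sum e Gr + sum e (Gl - Gr)"
      using sum.subset_diff[OF \<Delta>(2,1), of e] \<Delta>(5) by (simp add: x_def add.commute)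
    then have "nrm x \<le> 2 powr (1 / \<rho>) * max R l"
      using quasi_triangle[of "sum e Gr" "sum e (Gl - Gr)"] by (simp only: R_def l_def)
    also have "\<dots> \<le> 2 powr (1 / \<rho>) * ((1 + 4 / c) * R)" by (intro mult_left_mono max_le) simp
    finally show ?thesis by (simp only: D_def mult.assoc)
  qed

  define T where "T = real Q powr \<alpha> * (F * R)"
  have T0: "T \<ge> 0" using F R by (simp add: T_def)
  have "weighted_lseq \<alpha> \<tau> (sigma_err smul nrm e x) \<le> ennreal (K * T)"
    \<comment> \<open>The approximants are \<open>0\<close>, the indicator of \<open>Gr\<close>, and \<open>x\<close> itself.\<close>
  proof (rule K(2)[where A = "D * R" and B = l and Q = Q and M = "2 * P"])
    show "0 \<le> D * R" "0 \<le> l" using D R l by auto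
    show "sigma_err smul nrm e x n \<le> ennreal (D * R)" for n
      unfolding x_def
      by (rule order_trans[OF sigma_err_sum_le[OF basis \<Delta>(1), of "{}"]])
        (use xR in \<open>simp_all add: x_def ennreal_leI\<close>)
    show "sigma_err smul nrm e x n \<le> ennreal l" if "n \<ge> Q" for n
      using sigma_err_sum_le[OF basis \<Delta>(1,2), of n] that Gr \<Delta> by (simp add: x_def l_def)
    show "sigma_err smul nrm e x n = 0" if "n > 2 * P" for n
    proof -
      have "card \<Delta> \<le> P + Q" using card_Un_le[of Gl Gr] Gl Gr by (simp add: \<Delta>_def)
      then have "card \<Delta> \<le> n" using that PQ by linarith
      then show ?thesis using sigma_err_sum_le[OF basis \<Delta>(1), of \<Delta> n] by (simp add: x_def nrm_0)
    qed
    show "real Q powr \<alpha> * (D * R) \<le> T"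
      unfolding T_def using F R by (intro mult_left_mono mult_right_mono) auto
    have "real (2 * P) powr \<alpha> * l = 2 powr \<alpha> * (real P powr \<alpha> * l)" by (simp add: powr_mult)
    also have "\<dots> \<le> 2 powr \<alpha> * (4 / c * (real Q powr \<alpha> * R))" by (intro mult_left_mono lR) auto
    also have "\<dots> = real Q powr \<alpha> * (2 powr \<alpha> * (4 / c) * R)" by simp
    also have "\<dots> \<le> T"
      unfolding T_def using F R by (intro mult_left_mono mult_right_mono) auto
    finally show "real (2 * P) powr \<alpha> * l \<le> T" .
  qed
  moreover have "nrm x \<le> T"
  proof -
    have "D * R \<le> 1 * (F * R)" using F R by (simp add: mult_right_mono)
    also have "\<dots> \<le> T" unfolding T_def
      using Q1 \<alpha> F R ge_one_powr_ge_zero[of "real Q" \<alpha>] by (intro mult_right_mono) auto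
    finally show ?thesis using xR by linarith
  qed
  ultimately have "approx_norm smul nrm e \<alpha> \<tau> x \<le> ennreal T + ennreal (K * T)"
    unfolding approx_norm_def by (intro add_mono ennreal_leI)
  also have "\<dots> = ennreal ((1 + K) * T)"
    using K T0 by (simp add: algebra_simps flip: ennreal_plus)
  finally have up: "approx_norm smul nrm e \<alpha> \<tau> x \<le> ennreal ((1 + K) * T)" .

  \<comment> \<open>The greedy algorithm may waste its first \<open>card (Gl - Gr)\<close> steps on \<open>Gl - Gr\<close>.\<close>
  have "ennreal (\<kappa> * (real (card (Gl - Gr)) powr \<alpha> * R)) \<le> weighted_lseq \<alpha> \<tau> (gamma_err smul nrm e x)"
  proof (rule \<kappa>(2))
    show "ennreal R \<le> gamma_err smul nrm e x n" if "n \<le> card (Gl - Gr)" for n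
      using gamma_err_sum_ge[OF unc \<Delta>(1,3) that] \<Delta> by (simp add: x_def R_def)
  qed (use R in auto)
  also have "\<dots> \<le> greedy_norm smul nrm e \<alpha> \<tau> x" by (simp add: greedy_norm_def)
  also have "\<dots> \<le> ennreal C * approx_norm smul nrm e \<alpha> \<tau> x"
    by (rule C(2), rule le_less_trans[OF up]) simp
  also have "\<dots> \<le> ennreal C * ennreal ((1 + K) * T)" by (intro mult_left_mono up) auto
  also have "\<dots> = ennreal (C * ((1 + K) * T))" using C K T0 by (simp add: ennreal_mult)
  finally have "\<kappa> * (real (card (Gl - Gr)) powr \<alpha> * R) \<le> C * ((1 + K) * T)"
    using C K T0 by (simp add: ennreal_le_iff)
  moreover have "\<kappa> * ((real P / 2) powr \<alpha> * R) \<le> \<kappa> * (real (card (Gl - Gr)) powr \<alpha> * R)"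
    using card_l \<alpha> R \<kappa> by (intro mult_left_mono mult_right_mono powr_mono2) auto
  ultimately have "\<kappa> * ((real P / 2) powr \<alpha>) * R \<le> C * (1 + K) * F * real Q powr \<alpha> * R"
    by (simp add: T_def mult_ac)
  then have "\<kappa> * ((real P / 2) powr \<alpha>) \<le> C * (1 + K) * F * real Q powr \<alpha>"
    using R by simp
  then have "real P powr \<alpha> \<le> B * real Q powr \<alpha>"
    using \<kappa>(1) by (simp add: B_def powr_divide divide_le_eq le_divide_eq mult_ac)
  then have "(real P / real Q) powr \<alpha> \<le> B"
    using Q1 by (simp add: powr_divide divide_le_eq)
  moreover have "B < (real P / real Q) powr \<alpha>"
    using powr_less_mono2[OF \<alpha> _ r(2)] \<alpha> B by (simp add: powr_powr)
  ultimately show False by simp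
qed

end
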